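(* Let $\mathcal{M}$ be a $d$-dimensional, complete and connected Riemannian manifold with a retraction $R$ such that $\mathrm{Inj}(\mathcal{M})>0$. Let $f\in\mathcal{C}^1_{sem}(\mathcal{M})$, $x\in\mathcal{M}$, $\eta\in T_x\mathcal{M}$ and $t\in\mathbb{R}$. If $\|t\eta\|<\mathrm{Inj}(\mathcal{M})$, then $$(f\circ R_x)'(t\eta;\eta)=f'\bigl(R_x(t\eta);\mathrm{D}R_x(t\eta)[\eta]\bigr).$$
   Context: Retraction: a smooth map $R:T\mathcal{M}\to\mathcal{M}$ with restriction $R_x:T_x\mathcal M\to\mathcal M$ satisfying $R_x(0_x)=x$ and $\mathrm{D}R_x(0_x)=\mathrm{id}_{T_x\mathcal{M}}$. Injectivity radius with respect to $R$: $\mathrm{Inj}(\mathcal{M})=\inf_{x}\mathrm{Inj}(x)$, with $\mathrm{Inj}(x)=\sup\{r>0\mid R_x:B(0_x,r)\to B_R(x,r)\text{ is injective}\}$, $B(0_x,r)=\{\eta\in T_x\mathcal{M}\mid\|\eta\|<r\}$, $B_R(x,r)=\{R_x(\eta)\mid\|\eta\|<r\}$ (possibly $\mathrm{Inj}(\mathcal M)=\infty$). Directional derivative on $\mathcal{M}$: $f'(y;\xi)=\lim_{s\to0^+}(f(\gamma(s))-f(y))/s$ for a smooth curve $\gamma$ with $\gamma(0)=y$, $\gamma'(0)=\xi$ (equivalently with $\gamma(s)=R_y(s\xi)$). The left-hand side is the usual directional derivative of $f\circ R_x$ on the vector space $T_x\mathcal{M}$ at the point $t\eta$ in the direction $\eta$.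 Semismoothness: a locally Lipschitz $f:\mathcal{M}\to\mathbb{R}$ is semismooth at $x$ if for some chart $(U,\varphi)$ at $x$ (the notion is chart-independent), for each $\nu\in\mathbb{R}^d$ and all sequences $t_k\searrow0$, $\theta_k\in\mathbb{R}^d$ with $\theta_k/t_k\to0$, and $\hat g_k\in\partial_c(f\circ\varphi^{-1})(\varphi(x)+t_k\nu+\theta_k)$ (Euclidean Clarke subdifferential), one has $\langle\hat g_k,\nu\rangle\to(f\circ\varphi^{-1})'(\varphi(x);\nu)$. $\mathcal{C}^1_{sem}(\mathcal{M})$ is the set of functions semismooth at every point of $\mathcal{M}$. *)

theory Defs
  imports "HOL-Analysis.Analysis" "HOL-Library.Function_Algebras"
begin

instantiation "fun" :: (type, real_vector) real_vector
begin

definition scaleR_fun :: "real \<Rightarrow> ('a \<Rightarrow> 'b) \<Rightarrow> 'a \<Rightarrow> 'b"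
  where "scaleR_fun r f = (\<lambda>x. r *\<^sub>R f x)"

instance
  by standard (simp_all add: scaleR_fun_def fun_eq_iff scaleR_add_right scaleR_add_left)

end

text \<open>\<open>Ck_on k S F\<close> and \<open>smooth_on S F\<close> are only used for open \<open>S\<close> and finite-dimensional domain,
  where they mean that \<open>F\<close> is \<open>k\<close> times continuously, resp. infinitely often, differentiable
  on \<open>S\<close>.\<close>

primrec Ck_on :: "nat \<Rightarrow> 'a::real_normed_vector set \<Rightarrow> ('a \<Rightarrow> 'b::real_normed_vector) \<Rightarrow> bool" where
  "Ck_on 0 S F \<longleftrightarrow> continuous_on S F"
| "Ck_on (Suc k) S F \<longleftrightarrow>
     (\<forall>x\<in>S. F differentiable (at x)) \<and> (\<forall>v. Ck_on k S (\<lambda>x. frechet_derivative F (at x) v))"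

definition smooth_on :: "'a::real_normed_vector set \<Rightarrow> ('a \<Rightarrow> 'b::real_normed_vector) \<Rightarrow> bool"
  where "smooth_on S F \<longleftrightarrow> (\<forall>k. Ck_on k S F)"

definition has_dir_deriv :: "('v::real_vector \<Rightarrow> real) \<Rightarrow> 'v \<Rightarrow> 'v \<Rightarrow> real \<Rightarrow> bool" where
  "has_dir_deriv F u v L \<longleftrightarrow> ((\<lambda>s. (F (u + s *\<^sub>R v) - F u) / s) \<longlongrightarrow> L) (at_right 0)"

definition dir_differentiable :: "('v::real_vector \<Rightarrow> real) \<Rightarrow> 'v \<Rightarrow> 'v \<Rightarrow> bool" where
  "dir_differentiable F u v \<longleftrightarrow> (\<exists>L. has_dir_deriv F u v L)"

definition dir_deriv :: "('v::real_vector \<Rightarrow> real) \<Rightarrow> 'v \<Rightarrow> 'v \<Rightarrow> real" where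
  "dir_deriv F u v = (THE L. has_dir_deriv F u v L)"

definition clarke_dir_deriv :: "('e::euclidean_space \<Rightarrow> real) \<Rightarrow> 'e \<Rightarrow> 'e \<Rightarrow> ereal" where
  "clarke_dir_deriv F u v =
     Limsup (nhds u \<times>\<^sub>F at_right 0) (\<lambda>(w, s). ereal ((F (w + s *\<^sub>R v) - F w) / s))"

definition clarke_subdiff :: "('e::euclidean_space \<Rightarrow> real) \<Rightarrow> 'e \<Rightarrow> 'e set" where
  "clarke_subdiff F u = {h. \<forall>v. ereal (h \<bullet> v) \<le> clarke_dir_deriv F u v}"

text \<open>A chart \<open>(U, \<phi>)\<close> is modelled with a total function \<open>\<phi>\<close> whose values outside \<open>U\<close> are
  irrelevant.  The manifold is the whole type \<open>'m\<close>.\<close>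

type_synonym ('m, 'e) chart = "'m set \<times> ('m \<Rightarrow> 'e)"

definition dom :: "('m, 'e) chart \<Rightarrow> 'm set" where
  "dom c = fst c"

definition coord :: "('m, 'e) chart \<Rightarrow> 'm \<Rightarrow> 'e" where
  "coord c = snd c"

definition param :: "('m, 'e) chart \<Rightarrow> 'e \<Rightarrow> 'm" where
  "param c = inv_into (dom c) (coord c)"

text \<open>A map between sets equipped with an atlas is smooth if all its coordinate representations
  are smooth with open domain; openness of these domains contains continuity.\<close>

definition smooth_map ::
  "('a, 'e::real_normed_vector) chart set \<Rightarrow> ('b, 'f::real_normed_vector) chart set \<Rightarrow> ('a \<Rightarrow> 'b) \<Rightarrow> bool"
  where
  "smooth_map A B h \<longleftrightarrow>
     h ` (\<Union>c\<in>A. dom c) \<subseteq> (\<Union>c\<in>B. dom c) \<and>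
     (\<forall>c\<in>A. \<forall>c'\<in>B.
        open (coord c ` (dom c \<inter> h -` dom c')) \<and>
        smooth_on (coord c ` (dom c \<inter> h -` dom c')) (coord c' \<circ> h \<circ> param c))"

definition is_chart :: "('m::topological_space, 'e::euclidean_space) chart \<Rightarrow> bool" where
  "is_chart c \<longleftrightarrow> open (dom c) \<and> open (coord c ` dom c) \<and>
     homeomorphism (dom c) (coord c ` dom c) (coord c) (param c)"

definition smooth_transition ::
  "('m::topological_space, 'e::euclidean_space) chart \<Rightarrow> ('m, 'e) chart \<Rightarrow> bool" where
  "smooth_transition c c' \<longleftrightarrow> smooth_on (coord c ` (dom c \<inter> dom c')) (coord c' \<circ> param c)"

text \<open>A smooth structure is a maximal smooth atlas.\<close>

definition smooth_structure :: "('m::topological_space, 'e::euclidean_space) chart set \<Rightarrow> bool" where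
  "smooth_structure A \<longleftrightarrow>
     (\<forall>c\<in>A. is_chart c) \<and> (\<Union>c\<in>A. dom c) = UNIV \<and>
     (\<forall>c\<in>A. \<forall>c'\<in>A. smooth_transition c c') \<and>
     (\<forall>c. is_chart c \<and> (\<forall>c'\<in>A. smooth_transition c c' \<and> smooth_transition c' c) \<longrightarrow> c \<in> A)"

text \<open>A tangent vector at \<open>p\<close> is the family of its coordinate vectors with respect to all charts
  at \<open>p\<close>, related by the differentials of the transition maps (and \<open>0\<close> for all other pairs).
  Addition, scalar multiplication and the zero vector are those of the function space.\<close>

type_synonym ('m, 'e) tvec = "('m, 'e) chart \<Rightarrow> 'e"

definition tangent_space ::
  "('m::topological_space, 'e::euclidean_space) chart set \<Rightarrow> 'm \<Rightarrow> ('m, 'e) tvec set" where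
  "tangent_space A p = {v.
     (\<forall>c. c \<notin> A \<or> p \<notin> dom c \<longrightarrow> v c = 0) \<and>
     (\<forall>c\<in>A. \<forall>c'\<in>A. p \<in> dom c \<longrightarrow> p \<in> dom c' \<longrightarrow>
        v c' = frechet_derivative (coord c' \<circ> param c) (at (coord c p)) (v c))}"

definition tangent_bundle_atlas ::
  "('m::topological_space, 'e::euclidean_space) chart set \<Rightarrow> ('m \<times> ('m, 'e) tvec, 'e \<times> 'e) chart set"
  where
  "tangent_bundle_atlas A =
     (\<lambda>c. ({(p, v). p \<in> dom c \<and> v \<in> tangent_space A p}, \<lambda>(p, v). (coord c p, v c))) ` A"

definition smooth_curve ::
  "('m::topological_space, 'e::euclidean_space) chart set \<Rightarrow> real set \<Rightarrow> (real \<Rightarrow> 'm) \<Rightarrow> bool" where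
  "smooth_curve A I \<gamma> \<longleftrightarrow> smooth_map {(I, id)} A \<gamma>"

definition velocity ::
  "('m::topological_space, 'e::euclidean_space) chart set \<Rightarrow> (real \<Rightarrow> 'm) \<Rightarrow> real \<Rightarrow> ('m, 'e) tvec" where
  "velocity A \<gamma> s =
     (\<lambda>c. if c \<in> A \<and> \<gamma> s \<in> dom c then vector_derivative (coord c \<circ> \<gamma>) (at s) else 0)"

text \<open>In the third clause, \<open>G u\<close> is the bilinear form given by the matrix of metric coefficients
  at the point with coordinates \<open>u\<close>.\<close>

definition riemannian_metric ::
  "('m::topological_space, 'e::euclidean_space) chart set \<Rightarrow>
   ('m \<Rightarrow> ('m, 'e) tvec \<Rightarrow> ('m, 'e) tvec \<Rightarrow> real) \<Rightarrow> bool" where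
  "riemannian_metric A g \<longleftrightarrow>
     (\<forall>p. \<forall>u\<in>tangent_space A p. \<forall>v\<in>tangent_space A p. \<forall>w\<in>tangent_space A p. \<forall>a b.
        g p u v = g p v u \<and> g p (a *\<^sub>R u + b *\<^sub>R v) w = a * g p u w + b * g p v w) \<and>
     (\<forall>p. \<forall>v\<in>tangent_space A p. v \<noteq> 0 \<longrightarrow> g p v v > 0) \<and>
     (\<forall>c\<in>A. \<exists>G. (\<forall>a b. smooth_on (coord c ` dom c) (\<lambda>u. G u a b)) \<and>
        (\<forall>p\<in>dom c. \<forall>v\<in>tangent_space A p. \<forall>w\<in>tangent_space A p.
           g p v w = G (coord c p) (v c) (w c)))"

definition tnorm ::
  "('m \<Rightarrow> ('m, 'e) tvec \<Rightarrow> ('m, 'e) tvec \<Rightarrow> real) \<Rightarrow> 'm \<Rightarrow> ('m, 'e) tvec \<Rightarrow> real" where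
  "tnorm g p v = sqrt (g p v v)"

definition curve_length ::
  "('m::topological_space, 'e::euclidean_space) chart set \<Rightarrow>
   ('m \<Rightarrow> ('m, 'e) tvec \<Rightarrow> ('m, 'e) tvec \<Rightarrow> real) \<Rightarrow> (real \<Rightarrow> 'm) \<Rightarrow> real" where
  "curve_length A g \<gamma> = integral {0..1} (\<lambda>s. tnorm g (\<gamma> s) (velocity A \<gamma> s))"

text \<open>\<open>pw_smooth_path A g p q l\<close>: some piecewise smooth curve from \<open>p\<close> to \<open>q\<close>, i.e. a finite
  concatenation of smooth segments parametrized over \<open>[0, 1]\<close>, has length \<open>l\<close>.\<close>

inductive pw_smooth_path ::
  "('m::topological_space, 'e::euclidean_space) chart set \<Rightarrow>
   ('m \<Rightarrow> ('m, 'e) tvec \<Rightarrow> ('m, 'e) tvec \<Rightarrow> real) \<Rightarrow> 'm \<Rightarrow> 'm \<Rightarrow> real \<Rightarrow> bool"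
  for A g where
  const: "pw_smooth_path A g p p 0"
| segment: "\<epsilon> > 0 \<Longrightarrow> smooth_curve A {-\<epsilon><..<1+\<epsilon>} \<gamma> \<Longrightarrow> pw_smooth_path A g (\<gamma> 1) q l \<Longrightarrow>
     pw_smooth_path A g (\<gamma> 0) q (curve_length A g \<gamma> + l)"

definition rdist ::
  "('m::topological_space, 'e::euclidean_space) chart set \<Rightarrow>
   ('m \<Rightarrow> ('m, 'e) tvec \<Rightarrow> ('m, 'e) tvec \<Rightarrow> real) \<Rightarrow> 'm \<Rightarrow> 'm \<Rightarrow> real" where
  "rdist A g p q = Inf {l. pw_smooth_path A g p q l}"

definition complete_riemannian ::
  "('m::topological_space, 'e::euclidean_space) chart set \<Rightarrow>
   ('m \<Rightarrow> ('m, 'e) tvec \<Rightarrow> ('m, 'e) tvec \<Rightarrow> real) \<Rightarrow> bool" where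
  "complete_riemannian A g \<longleftrightarrow>
     (\<forall>\<sigma> :: nat \<Rightarrow> 'm. (\<forall>e>0. \<exists>N. \<forall>m\<ge>N. \<forall>n\<ge>N. rdist A g (\<sigma> m) (\<sigma> n) < e) \<longrightarrow>
        (\<exists>p. (\<lambda>n. rdist A g (\<sigma> n) p) \<longlonglongrightarrow> 0))"

text \<open>\<open>retr_diff A R x \<eta> \<xi>\<close> is the differential of \<open>R x\<close> at \<open>\<eta>\<close> applied to \<open>\<xi>\<close>, as a tangent vector
  at \<open>R x \<eta>\<close>, with the tangent space of the vector space \<open>tangent_space A x\<close> at \<open>\<eta>\<close> identified
  with that vector space itself.\<close>

definition retr_diff ::
  "('m::topological_space, 'e::euclidean_space) chart set \<Rightarrow> ('m \<Rightarrow> ('m, 'e) tvec \<Rightarrow> 'm) \<Rightarrow>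
   'm \<Rightarrow> ('m, 'e) tvec \<Rightarrow> ('m, 'e) tvec \<Rightarrow> ('m, 'e) tvec" where
  "retr_diff A R x \<eta> \<xi> = velocity A (\<lambda>s. R x (\<eta> + s *\<^sub>R \<xi>)) 0"

definition mfd_retraction ::
  "('m::topological_space, 'e::euclidean_space) chart set \<Rightarrow> ('m \<Rightarrow> ('m, 'e) tvec \<Rightarrow> 'm) \<Rightarrow> bool" where
  "mfd_retraction A R \<longleftrightarrow>
     smooth_map (tangent_bundle_atlas A) A (\<lambda>(x, v). R x v) \<and>
     (\<forall>x. R x 0 = x \<and> (\<forall>\<xi>\<in>tangent_space A x. retr_diff A R x 0 \<xi> = \<xi>))"

definition inj_radius_at ::
  "('m::topological_space, 'e::euclidean_space) chart set \<Rightarrow>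
   ('m \<Rightarrow> ('m, 'e) tvec \<Rightarrow> ('m, 'e) tvec \<Rightarrow> real) \<Rightarrow> ('m \<Rightarrow> ('m, 'e) tvec \<Rightarrow> 'm) \<Rightarrow> 'm \<Rightarrow> ereal" where
  "inj_radius_at A g R x =
     Sup (ereal ` {r. r > 0 \<and> inj_on (R x) {\<eta> \<in> tangent_space A x. tnorm g x \<eta> < r}})"

definition inj_radius ::
  "('m::topological_space, 'e::euclidean_space) chart set \<Rightarrow>
   ('m \<Rightarrow> ('m, 'e) tvec \<Rightarrow> ('m, 'e) tvec \<Rightarrow> real) \<Rightarrow> ('m \<Rightarrow> ('m, 'e) tvec \<Rightarrow> 'm) \<Rightarrow> ereal" where
  "inj_radius A g R = (INF x. inj_radius_at A g R x)"

definition curve_through ::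
  "('m::topological_space, 'e::euclidean_space) chart set \<Rightarrow> 'm \<Rightarrow> ('m, 'e) tvec \<Rightarrow> (real \<Rightarrow> 'm) \<Rightarrow> bool"
  where
  "curve_through A y \<xi> \<gamma> \<longleftrightarrow>
     (\<exists>\<epsilon>>0. smooth_curve A {-\<epsilon><..<\<epsilon>} \<gamma>) \<and> \<gamma> 0 = y \<and> velocity A \<gamma> 0 = \<xi>"

text \<open>The limit is required to be independent of the curve; the existence of a curve excludes
  vectors \<open>\<xi>\<close> that are not tangent at \<open>y\<close>.\<close>

definition has_mdir_deriv ::
  "('m::topological_space, 'e::euclidean_space) chart set \<Rightarrow> ('m \<Rightarrow> real) \<Rightarrow>
   'm \<Rightarrow> ('m, 'e) tvec \<Rightarrow> real \<Rightarrow> bool" where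
  "has_mdir_deriv A f y \<xi> L \<longleftrightarrow>
     (\<exists>\<gamma>. curve_through A y \<xi> \<gamma>) \<and>
     (\<forall>\<gamma>. curve_through A y \<xi> \<gamma> \<longrightarrow> ((\<lambda>s. (f (\<gamma> s) - f y) / s) \<longlongrightarrow> L) (at_right 0))"

definition mdir_differentiable ::
  "('m::topological_space, 'e::euclidean_space) chart set \<Rightarrow> ('m \<Rightarrow> real) \<Rightarrow>
   'm \<Rightarrow> ('m, 'e) tvec \<Rightarrow> bool" where
  "mdir_differentiable A f y \<xi> \<longleftrightarrow> (\<exists>L. has_mdir_deriv A f y \<xi> L)"

definition mdir_deriv ::
  "('m::topological_space, 'e::euclidean_space) chart set \<Rightarrow> ('m \<Rightarrow> real) \<Rightarrow>
   'm \<Rightarrow> ('m, 'e) tvec \<Rightarrow> real" where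
  "mdir_deriv A f y \<xi> = (THE L. has_mdir_deriv A f y \<xi> L)"

definition locally_lipschitz ::
  "('m::topological_space, 'e::euclidean_space) chart set \<Rightarrow>
   ('m \<Rightarrow> ('m, 'e) tvec \<Rightarrow> ('m, 'e) tvec \<Rightarrow> real) \<Rightarrow> ('m \<Rightarrow> real) \<Rightarrow> bool" where
  "locally_lipschitz A g f \<longleftrightarrow>
     (\<forall>x. \<exists>U L. open U \<and> x \<in> U \<and> (\<forall>y\<in>U. \<forall>z\<in>U. \<bar>f y - f z\<bar> \<le> L * rdist A g y z))"

text \<open>The function \<open>f \<circ> param c\<close> is meaningful only on the open set \<open>coord c ` dom c\<close>, so the
  sequences are required to stay in that set.\<close>

definition semismooth_at ::
  "('m::topological_space, 'e::euclidean_space) chart set \<Rightarrow>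
   ('m \<Rightarrow> ('m, 'e) tvec \<Rightarrow> ('m, 'e) tvec \<Rightarrow> real) \<Rightarrow> ('m \<Rightarrow> real) \<Rightarrow> 'm \<Rightarrow> bool" where
  "semismooth_at A g f x \<longleftrightarrow> locally_lipschitz A g f \<and>
     (\<exists>c\<in>A. x \<in> dom c \<and>
       (\<forall>\<nu>. dir_differentiable (f \<circ> param c) (coord c x) \<nu> \<and>
         (\<forall>(t :: nat \<Rightarrow> real) \<theta> h.
            (\<forall>k. t k > 0) \<and> t \<longlonglongrightarrow> 0 \<and> (\<lambda>k. \<theta> k /\<^sub>R t k) \<longlonglongrightarrow> 0 \<and>
            (\<forall>k. coord c x + t k *\<^sub>R \<nu> + \<theta> k \<in> coord c ` dom c \<and>
                 h k \<in> clarke_subdiff (f \<circ> param c) (coord c x + t k *\<^sub>R \<nu> + \<theta> k))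
            \<longrightarrow> (\<lambda>k. h k \<bullet> \<nu>) \<longlonglongrightarrow> dir_deriv (f \<circ> param c) (coord c x) \<nu>)))"

definition C1_sem ::
  "('m::topological_space, 'e::euclidean_space) chart set \<Rightarrow>
   ('m \<Rightarrow> ('m, 'e) tvec \<Rightarrow> ('m, 'e) tvec \<Rightarrow> real) \<Rightarrow> ('m \<Rightarrow> real) set" where
  "C1_sem A g = {f. \<forall>x. semismooth_at A g f x}"

end

theory Submission
  imports Defs
begin

text \<open>Straight segments in a chart bound the Riemannian distance by a multiple of the Euclidean
  distance of coordinates, so a locally Lipschitz function on the manifold is locally Lipschitz in
  the chart. Such a function cannot distinguish a curve from its tangent line to first order, hence
  its directional derivative in the chart, which exists by semismoothness, is the limit of the
  difference quotients along every smooth curve with the given velocity. The curve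
  \<open>s \<mapsto> R x (t \<eta> + s \<eta>)\<close> is one of them, and the difference quotients of \<open>f\<close> along it are those
  of \<open>f \<circ> R x\<close>.\<close>

section \<open>Derivatives and higher smoothness on open sets\<close>

lemma frechet_derivative_cong_open:
  assumes "open S" "x \<in> S" "\<And>y. y \<in> S \<Longrightarrow> F y = G y"
  shows "frechet_derivative F (at x) = frechet_derivative G (at x)"
proof -
  have "(F has_derivative D) (at x) \<longleftrightarrow> (G has_derivative D) (at x)" for D
    using assms by (metis has_derivative_transform_within_open)
  then show ?thesis
    by (simp add: frechet_derivative_def)
qed

lemma Ck_on_cong:
  assumes "open S" "\<And>y. y \<in> S \<Longrightarrow> F y = G y"
  shows "Ck_on k S F \<longleftrightarrow> Ck_on k S G"
  using assms(2)
proof (induction k arbitrary: F G)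
  case 0
  then show ?case
    by (simp cong: continuous_on_cong)
next
  case (Suc k)
  have "F differentiable (at x) \<longleftrightarrow> G differentiable (at x)" if "x \<in> S" for x
    using assms(1) that Suc.prems unfolding differentiable_def
    by (metis has_derivative_transform_within_open)
  moreover have "Ck_on k S (\<lambda>x. frechet_derivative F (at x) v) \<longleftrightarrow>
      Ck_on k S (\<lambda>x. frechet_derivative G (at x) v)" for v
    using frechet_derivative_cong_open[OF assms(1) _ Suc.prems] by (intro Suc.IH) auto
  ultimately show ?case
    by simp
qed

lemma smooth_on_cong:
  assumes "open S" "\<And>y. y \<in> S \<Longrightarrow> F y = G y"
  shows "smooth_on S F \<longleftrightarrow> smooth_on S G"
  using Ck_on_cong[OF assms] by (simp add: smooth_on_def)

lemma smooth_on_has_derivative: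
  assumes "smooth_on S F" "x \<in> S"
  shows "(F has_derivative frechet_derivative F (at x)) (at x)"
proof -
  have "Ck_on (Suc 0) S F"
    using assms(1) by (simp only: smooth_on_def)
  then show ?thesis
    using assms(2) frechet_derivative_works by auto
qed

lemma smooth_on_continuous_on: "smooth_on S F \<Longrightarrow> continuous_on S F"
  by (metis Ck_on.simps(1) smooth_on_def)

text \<open>The differential of the inner map is the constant \<open>L\<close>, so the derivative of
  the composite in direction \<open>v\<close> is again a composite with the same affine map, now of
  the derivative of \<open>F\<close> in direction \<open>L v\<close>. The induction thus closes
  without a product rule.\<close>

lemma Ck_on_compose_affine:
  assumes L: "bounded_linear L" and T: "open T" and sub: "\<And>s. s \<in> T \<Longrightarrow> a + L s \<in> S"
    and "Ck_on k S F"
  shows "Ck_on k T (\<lambda>s. F (a + L s))"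
  using assms(4)
proof (induction k arbitrary: F)
  case 0
  have "continuous_on T (\<lambda>s. a + L s)"
    by (intro continuous_intros linear_continuous_on L)
  then show ?case
    using 0 sub by (auto intro: continuous_on_compose2)
next
  case (Suc k)
  have der: "((\<lambda>s. F (a + L s)) has_derivative (\<lambda>v. frechet_derivative F (at (a + L s)) (L v))) (at s)"
    if "s \<in> T" for s
  proof -
    have "((\<lambda>s. a + L s) has_derivative L) (at s)"
      using has_derivative_add[OF has_derivative_const bounded_linear_imp_has_derivative[OF L]]
      by simp
    moreover have "(F has_derivative frechet_derivative F (at (a + L s))) (at (a + L s))"
      using Suc.prems sub[OF that] frechet_derivative_works by auto
    ultimately show ?thesis
      using has_derivative_compose by blast
  qed
  have eq: "frechet_derivative (\<lambda>s. F (a + L s)) (at s) v = frechet_derivative F (at (a + L s)) (L v)"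
    if "s \<in> T" for s v
    unfolding frechet_derivative_at[OF der[OF that], symmetric] ..
  have "Ck_on k T (\<lambda>s. frechet_derivative F (at (a + L s)) (L v))" for v
    using Suc.prems by (intro Suc.IH) simp
  then have "Ck_on k T (\<lambda>s. frechet_derivative (\<lambda>s. F (a + L s)) (at s) v)" for v
    using Ck_on_cong[OF T, of "\<lambda>s. frechet_derivative (\<lambda>s. F (a + L s)) (at s) v"
        "\<lambda>s. frechet_derivative F (at (a + L s)) (L v)" k] eq by simp
  then show ?case
    using der by (auto simp: differentiable_def)
qed

text \<open>Serves both for lines in a chart of the manifold and for lines in a fibre of the tangent
  bundle.\<close>

lemma smooth_on_compose_line:
  assumes "open T" "\<And>s. s \<in> T \<Longrightarrow> a + s *\<^sub>R w \<in> S" "smooth_on S F"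
  shows "smooth_on T (\<lambda>s. F (a + s *\<^sub>R w))"
  using assms Ck_on_compose_affine[OF bounded_linear_scaleR_left[of w], of T a S] by (auto simp: smooth_on_def)

section \<open>Charts and their inverse parametrizations\<close>

lemma param_coord:
  assumes "is_chart c" "p \<in> dom c"
  shows "param c (coord c p) = p"
  using assms by (auto simp: is_chart_def homeomorphism_def)

lemma coord_param:
  assumes "is_chart c" "u \<in> coord c ` dom c"
  shows "coord c (param c u) = u" "param c u \<in> dom c"
  using assms by (auto simp: is_chart_def homeomorphism_def)

text \<open>As a preimage under \<open>param c\<close>, this set can be shown open by continuity of
  \<open>param c\<close>.\<close>

lemma coord_image_Int:
  assumes "is_chart c"
  shows "coord c ` (dom c \<inter> S) = param c -` S \<inter> coord c ` dom c"
  using param_coord[OF assms] by auto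

lemma open_coord_image:
  assumes "is_chart c" "open S"
  shows "open (coord c ` (dom c \<inter> S))"
proof -
  have "continuous_on (coord c ` dom c) (param c)" "open (coord c ` dom c)"
    using assms(1) by (auto simp: is_chart_def homeomorphism_def)
  then show ?thesis
    using assms(2) by (simp add: coord_image_Int[OF assms(1)] continuous_on_open_vimage)
qed

section \<open>Uniqueness of directional derivatives, and their values along curves\<close>

lemma has_dir_deriv_unique: "has_dir_deriv F u v L \<Longrightarrow> has_dir_deriv F u v L' \<Longrightarrow> L = L'"
  unfolding has_dir_deriv_def by (rule tendsto_unique[OF trivial_limit_at_right_real])

lemma dir_deriv_eqI: "has_dir_deriv F u v L \<Longrightarrow> dir_deriv F u v = L"
  unfolding dir_deriv_def by (blast intro: has_dir_deriv_unique the_equality)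

lemma has_mdir_deriv_unique: "has_mdir_deriv A f y v L \<Longrightarrow> has_mdir_deriv A f y v L' \<Longrightarrow> L = L'"
  unfolding has_mdir_deriv_def by (meson tendsto_unique[OF trivial_limit_at_right_real])

lemma mdir_deriv_eqI: "has_mdir_deriv A f y v L \<Longrightarrow> mdir_deriv A f y v = L"
  unfolding mdir_deriv_def by (blast intro: has_mdir_deriv_unique the_equality)

text \<open>The curve deviates from its tangent line by an error of order o(s). The Lipschitz bound
  passes this order on to the values of \<open>F\<close>, so the quotients along the curve and along
  the line have the same limit.\<close>

lemma lipschitz_dir_deriv_along_curve:
  fixes \<beta> :: "real \<Rightarrow> 'e::real_normed_vector"
  assumes lip: "r > 0" "\<And>u v. u \<in> ball (\<beta> 0) r \<Longrightarrow> v \<in> ball (\<beta> 0) r \<Longrightarrow> \<bar>F u - F v\<bar> \<le> K * norm (u - v)"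
    and \<beta>: "(\<beta> has_vector_derivative \<nu>) (at 0)"
    and F: "has_dir_deriv F (\<beta> 0) \<nu> L"
  shows "((\<lambda>s. (F (\<beta> s) - F (\<beta> 0)) / s) \<longlongrightarrow> L) (at_right 0)"
proof -
  define e where "e = (\<lambda>s. \<beta> s - (\<beta> 0 + s *\<^sub>R \<nu>))"
  have "e s = \<beta> s - \<beta> 0 - s *\<^sub>R \<nu>" for s
    by (simp add: e_def)
  then have "((\<lambda>s. e s /\<^sub>R norm s) \<longlongrightarrow> 0) (at 0)"
    using \<beta> by (simp add: has_vector_derivative_def has_derivative_at_within has_derivative_def divide_inverse)
  then have "((\<lambda>s. e s /\<^sub>R norm s) \<longlongrightarrow> 0) (at_right 0)"
    by (rule filterlim_mono) (auto intro: at_le)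
  then have small: "((\<lambda>s. K * norm (e s /\<^sub>R norm s)) \<longlongrightarrow> 0) (at_right 0)"
    by (intro tendsto_mult_right_zero tendsto_norm_zero)
  have "isCont \<beta> 0"
    using \<beta> by (rule has_vector_derivative_continuous)
  then have "(\<beta> \<longlongrightarrow> \<beta> 0) (at_right 0)"
    unfolding isCont_def by (rule filterlim_mono) (auto intro: at_le)
  \<comment> \<open>The Lipschitz bound is available only inside the ball, so for small
    \<open>s\<close> both the curve and its tangent line have to lie there.\<close>
  then have near: "\<forall>\<^sub>F s in at_right 0. \<beta> s \<in> ball (\<beta> 0) r"
    by (rule topological_tendstoD) (use lip in auto)
  have "((\<lambda>s. \<beta> 0 + s *\<^sub>R \<nu>) \<longlongrightarrow> \<beta> 0 + 0 *\<^sub>R \<nu>) (at_right 0)"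
    by (intro tendsto_intros)
  then have near': "\<forall>\<^sub>F s in at_right 0. \<beta> 0 + s *\<^sub>R \<nu> \<in> ball (\<beta> 0) r"
    by (rule topological_tendstoD) (use lip in auto)
  have "\<forall>\<^sub>F s in at_right 0. norm ((F (\<beta> s) - F (\<beta> 0 + s *\<^sub>R \<nu>)) / s) \<le> K * norm (e s /\<^sub>R norm s)"
    using near near' eventually_at_right_less[of 0]
  proof eventually_elim
    case (elim s)
    then have "\<bar>F (\<beta> s) - F (\<beta> 0 + s *\<^sub>R \<nu>)\<bar> \<le> K * norm (e s)"
      using lip(2) unfolding e_def by blast
    then show ?case
      using elim(3) by (simp add: field_simps)
  qed
  then have "((\<lambda>s. (F (\<beta> s) - F (\<beta> 0 + s *\<^sub>R \<nu>)) / s) \<longlongrightarrow> 0) (at_right 0)"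
    using small by (rule Lim_null_comparison)
  \<comment> \<open>The quotient along the curve is this vanishing term plus the quotient along the
    tangent line.\<close>
  from tendsto_add[OF this F[unfolded has_dir_deriv_def]] show ?thesis
    by (simp add: diff_divide_distrib)
qed

section \<open>Charts of a manifold, smooth curves and their velocities\<close>

locale smooth_manifold =
  fixes A :: "('m::topological_space, 'e::euclidean_space) chart set"
  assumes smooth_structure: "smooth_structure A"
begin

lemma is_chart: "c \<in> A \<Longrightarrow> is_chart c"
  using smooth_structure unfolding smooth_structure_def by (elim conjE) (rule bspec)

lemma Union_dom: "(\<Union>c\<in>A. dom c) = UNIV"
  using smooth_structure unfolding smooth_structure_def by (elim conjE)

lemma obtain_chart: obtains c where "c \<in> A" "p \<in> dom c"
  using Union_dom by blast

lemma open_dom: "c \<in> A \<Longrightarrow> open (dom c)"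
  using is_chart by (auto simp: is_chart_def)

lemma open_coord_dom: "c \<in> A \<Longrightarrow> open (coord c ` dom c)"
  using is_chart by (auto simp: is_chart_def)

lemma transition_smooth:
  assumes "c \<in> A" "c' \<in> A"
  shows "smooth_on (coord c ` (dom c \<inter> dom c')) (coord c' \<circ> param c)"
proof -
  have "\<forall>c\<in>A. \<forall>c'\<in>A. smooth_transition c c'"
    using smooth_structure unfolding smooth_structure_def by (elim conjE)
  then show ?thesis
    using assms by (simp add: smooth_transition_def)
qed

lemma transition_has_derivative:
  assumes "c \<in> A" "c' \<in> A" "p \<in> dom c" "p \<in> dom c'"
  shows "(coord c' \<circ> param c has_derivative
    frechet_derivative (coord c' \<circ> param c) (at (coord c p))) (at (coord c p))"
  using smooth_on_has_derivative[OF transition_smooth[OF assms(1,2)]] assms(3,4) by blast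

text \<open>The only chart \<open>(I, id)\<close> of the source has the identity as coordinate, so
  the images in \<open>smooth_map\<close> become plain preimages under the curve. The condition on
  the range is automatic because the charts cover the manifold.\<close>

lemma smooth_curve_iff:
  "smooth_curve A I \<gamma> \<longleftrightarrow>
    (\<forall>c\<in>A. open (I \<inter> \<gamma> -` dom c) \<and> smooth_on (I \<inter> \<gamma> -` dom c) (coord c \<circ> \<gamma>))"
proof -
  \<comment> \<open>\<open>param (I, id)\<close> is \<open>inv_into I id\<close>, which is the
    identity on \<open>I\<close> but arbitrary outside.\<close>
  have "(coord c \<circ> \<gamma> \<circ> param (I, id)) s = (coord c \<circ> \<gamma>) s" if "s \<in> I" for c :: "('m, 'e) chart" and s
    using that inv_into_f_f[of id I s] by (simp add: param_def dom_def coord_def)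
  then have *: "open (I \<inter> \<gamma> -` dom c) \<Longrightarrow> smooth_on (I \<inter> \<gamma> -` dom c) (coord c \<circ> \<gamma> \<circ> param (I, id)) \<longleftrightarrow>
      smooth_on (I \<inter> \<gamma> -` dom c) (coord c \<circ> \<gamma>)" for c :: "('m, 'e) chart"
    by (intro smooth_on_cong) auto
  show ?thesis
    using * Union_dom by (auto simp: smooth_curve_def smooth_map_def dom_def coord_def)
qed

lemma smooth_curve_has_velocity:
  assumes "smooth_curve A I \<gamma>" "s \<in> I" "c \<in> A" "\<gamma> s \<in> dom c"
  shows "(coord c \<circ> \<gamma> has_vector_derivative velocity A \<gamma> s c) (at s)"
proof -
  have "smooth_on (I \<inter> \<gamma> -` dom c) (coord c \<circ> \<gamma>)"
    using assms by (simp add: smooth_curve_iff)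
  then have "coord c \<circ> \<gamma> differentiable (at s)"
    using assms smooth_on_has_derivative[of _ "coord c \<circ> \<gamma>" s] by (auto simp: differentiable_def)
  then show ?thesis
    using assms by (simp add: velocity_def vector_derivative_works)
qed

text \<open>Compatibility of the coordinate velocities is the chain rule for the transition
  maps.\<close>

lemma velocity_in_tangent_space:
  assumes "smooth_curve A I \<gamma>" "s \<in> I"
  shows "velocity A \<gamma> s \<in> tangent_space A (\<gamma> s)"
proof -
  have "velocity A \<gamma> s c' =
      frechet_derivative (coord c' \<circ> param c) (at (coord c (\<gamma> s))) (velocity A \<gamma> s c)"
    if c: "c \<in> A" "c' \<in> A" "\<gamma> s \<in> dom c" "\<gamma> s \<in> dom c'" for c c'
  proof -
    have "(coord c \<circ> \<gamma> has_derivative (\<lambda>h. h *\<^sub>R velocity A \<gamma> s c)) (at s)"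
      using smooth_curve_has_velocity[OF assms c(1,3)] by (simp add: has_vector_derivative_def)
    from diff_chain_at[OF this] transition_has_derivative[OF c]
    have "((coord c' \<circ> param c) \<circ> (coord c \<circ> \<gamma>) has_derivative
        frechet_derivative (coord c' \<circ> param c) (at (coord c (\<gamma> s))) \<circ> (\<lambda>h. h *\<^sub>R velocity A \<gamma> s c)) (at s)"
      by simp
    \<comment> \<open>The chart \<open>c\<close> cancels only while the curve stays in
      \<open>dom c\<close>; openness ensures this near \<open>s\<close>.\<close>
    moreover have "open (I \<inter> \<gamma> -` dom c)"
      using assms c by (simp add: smooth_curve_iff)
    ultimately have "(coord c' \<circ> \<gamma> has_derivative
        frechet_derivative (coord c' \<circ> param c) (at (coord c (\<gamma> s))) \<circ> (\<lambda>h. h *\<^sub>R velocity A \<gamma> s c)) (at s)"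
      by (rule has_derivative_transform_within_open)
        (use assms c param_coord[OF is_chart] in auto)
    moreover have "(coord c' \<circ> \<gamma> has_derivative (\<lambda>h. h *\<^sub>R velocity A \<gamma> s c')) (at s)"
      using smooth_curve_has_velocity[OF assms c(2,4)] by (simp add: has_vector_derivative_def)
    \<comment> \<open>Both linear maps on the reals are the same derivative; their values at 1 are
      the vectors to be compared.\<close>
    ultimately show ?thesis
      using has_derivative_unique by (fastforce dest: fun_cong[where x = 1])
  qed
  moreover have "velocity A \<gamma> s c = 0" if "c \<notin> A \<or> \<gamma> s \<notin> dom c" for c
    using that by (auto simp: velocity_def)
  ultimately show ?thesis
    unfolding tangent_space_def by blast
qed

lemma smooth_curve_coordinate_line:
  assumes c: "c \<in> A" and I: "open I" "\<And>s. s \<in> I \<Longrightarrow> u + s *\<^sub>R w \<in> coord c ` dom c"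
  shows "smooth_curve A I (\<lambda>s. param c (u + s *\<^sub>R w))"
  unfolding smooth_curve_iff
proof (intro ballI conjI)
  fix c' assume c': "c' \<in> A"
  let ?T = "I \<inter> (\<lambda>s. param c (u + s *\<^sub>R w)) -` dom c'"
  have T: "?T = (\<lambda>s. u + s *\<^sub>R w) -` (coord c ` (dom c \<inter> dom c')) \<inter> I"
    using I(2) by (auto simp: coord_image_Int[OF is_chart[OF c]])
  have "continuous_on I (\<lambda>s. u + s *\<^sub>R w)"
    by (intro continuous_intros)
  then show op: "open ?T"
    unfolding T using I(1) open_coord_image[OF is_chart[OF c] open_dom[OF c']]
    by (simp add: continuous_on_open_vimage)
  have "smooth_on ?T (\<lambda>s. (coord c' \<circ> param c) (u + s *\<^sub>R w))"
    by (rule smooth_on_compose_line[OF op _ transition_smooth[OF c c']]) (use T in blast)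
  then show "smooth_on ?T (coord c' \<circ> (\<lambda>s. param c (u + s *\<^sub>R w)))"
    by (simp add: o_def)
qed

lemma velocity_coordinate_line:
  assumes c: "c \<in> A" and I: "open I" "\<And>s. s \<in> I \<Longrightarrow> u + s *\<^sub>R w \<in> coord c ` dom c" and s: "s \<in> I"
  shows "velocity A (\<lambda>s. param c (u + s *\<^sub>R w)) s c = w"
proof -
  have "((\<lambda>s. u + s *\<^sub>R w) has_vector_derivative w) (at s)"
    by (auto intro!: derivative_eq_intros simp: has_vector_derivative_def)
  then have "(coord c \<circ> (\<lambda>s. param c (u + s *\<^sub>R w)) has_vector_derivative w) (at s)"
    by (rule has_vector_derivative_transform_within_open[OF _ I(1) s])
      (use I(2) coord_param[OF is_chart[OF c]] in auto)
  then show ?thesis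
    using c coord_param(2)[OF is_chart[OF c] I(2)[OF s]] by (simp add: velocity_def vector_derivative_at)
qed

text \<open>The line with direction \<open>w\<close> in the chart has a velocity with coordinate
  \<open>w\<close>. Facts about tangent vectors thereby transfer to arbitrary vectors of the model
  space.\<close>

lemma tangent_space_lift:
  assumes c: "c \<in> A" "p \<in> dom c"
  obtains v where "v \<in> tangent_space A p" "v c = w"
proof -
  define I where "I = (\<lambda>s. coord c p + s *\<^sub>R w) -` (coord c ` dom c)"
  have I: "open I" "0 \<in> I"
    using c by (auto simp: I_def intro!: continuous_open_vimage open_coord_dom continuous_intros)
  have sub: "\<And>s. s \<in> I \<Longrightarrow> coord c p + s *\<^sub>R w \<in> coord c ` dom c"
    by (simp add: I_def)
  show thesis
    using that velocity_coordinate_line[OF c(1) I(1) sub I(2)]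
      velocity_in_tangent_space[OF smooth_curve_coordinate_line[OF c(1) I(1) sub] I(2)]
      param_coord[OF is_chart c(2)] c(1) by auto
qed

section \<open>Linear structure of tangent spaces, and images of their lines under the
  retraction\<close>

lemma tangent_space_transition:
  assumes "v \<in> tangent_space A p" "c \<in> A" "c' \<in> A" "p \<in> dom c" "p \<in> dom c'"
  shows "v c' = frechet_derivative (coord c' \<circ> param c) (at (coord c p)) (v c)"
  using assms unfolding tangent_space_def by blast

lemma tangent_space_outside: "v \<in> tangent_space A p \<Longrightarrow> c \<notin> A \<or> p \<notin> dom c \<Longrightarrow> v c = 0"
  unfolding tangent_space_def by blast

text \<open>A single chart at \<open>p\<close> suffices: transition differentials fix the components
  in the other charts at \<open>p\<close>, and all remaining components vanish.\<close>

lemma tangent_space_eqI: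
  assumes "v \<in> tangent_space A p" "w \<in> tangent_space A p" "c \<in> A" "p \<in> dom c" "v c = w c"
  shows "v = w"
proof
  fix c'
  show "v c' = w c'"
    using assms tangent_space_transition tangent_space_outside by metis
qed

lemma tangent_space_add_scaleR:
  assumes "v \<in> tangent_space A p" "w \<in> tangent_space A p"
  shows "v + s *\<^sub>R w \<in> tangent_space A p"
  unfolding tangent_space_def
proof (intro CollectI conjI allI impI ballI)
  fix c assume "c \<notin> A \<or> p \<notin> dom c"
  then show "(v + s *\<^sub>R w) c = 0"
    using assms by (simp add: tangent_space_outside scaleR_fun_def)
next
  fix c c' assume c: "c \<in> A" "c' \<in> A" "p \<in> dom c" "p \<in> dom c'"
  have "linear (frechet_derivative (coord c' \<circ> param c) (at (coord c p)))"
    using transition_has_derivative[OF c] has_derivative_linear by blast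
  moreover have "v c' = frechet_derivative (coord c' \<circ> param c) (at (coord c p)) (v c)"
      "w c' = frechet_derivative (coord c' \<circ> param c) (at (coord c p)) (w c)"
    using assms c tangent_space_transition by blast+
  ultimately show "(v + s *\<^sub>R w) c' =
      frechet_derivative (coord c' \<circ> param c) (at (coord c p)) ((v + s *\<^sub>R w) c)"
    by (simp add: scaleR_fun_def linear_add linear_scale)
qed

lemma zero_in_tangent_space: "0 \<in> tangent_space A p"
proof -
  have "frechet_derivative (coord c' \<circ> param c) (at (coord c p)) 0 = 0"
    if "c \<in> A" "c' \<in> A" "p \<in> dom c" "p \<in> dom c'" for c c'
    using transition_has_derivative[OF that] has_derivative_linear linear_0 by metis
  then show ?thesis
    by (auto simp: tangent_space_def)
qed

text \<open>In the bundle chart over a chart \<open>c\<close> at \<open>x\<close>, the line in the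
  fibre over \<open>x\<close> is the straight line through \<open>(coord c x, v c)\<close> with
  direction \<open>(0, w c)\<close>. The curve is thus a coordinate representation of the retraction
  restricted to a line.\<close>

lemma smooth_curve_retraction_line:
  assumes R: "mfd_retraction A R" and v: "v \<in> tangent_space A x" and w: "w \<in> tangent_space A x"
    and I: "open I"
  shows "smooth_curve A I (\<lambda>s. R x (v + s *\<^sub>R w))"
  unfolding smooth_curve_iff
proof (intro ballI conjI)
  fix c' assume c': "c' \<in> A"
  obtain c where c: "c \<in> A" "x \<in> dom c"
    by (rule obtain_chart)
  define B where
    "B = ({(p, v). p \<in> dom c \<and> v \<in> tangent_space A p}, \<lambda>(p, v :: ('m, 'e) tvec). (coord c p, v c))"
  let ?h = "\<lambda>(x, v). R x v"
  let ?W = "coord B ` (dom B \<inter> ?h -` dom c')"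
  have "B \<in> tangent_bundle_atlas A"
    using c by (auto simp: B_def tangent_bundle_atlas_def)
  then have W: "open ?W" "smooth_on ?W (coord c' \<circ> ?h \<circ> param B)"
    using R c' unfolding mfd_retraction_def smooth_map_def by blast+
  \<comment> \<open>\<open>param B\<close> is an \<open>inv_into\<close>, so it inverts
    \<open>coord B\<close> on \<open>dom B\<close> only once injectivity is known.\<close>
  have inj: "inj_on (coord B) (dom B)"
  proof (rule inj_onI)
    fix a b assume ab: "a \<in> dom B" "b \<in> dom B" "coord B a = coord B b"
    obtain p v q w where [simp]: "a = (p, v)" "b = (q, w)"
      by fastforce
    have "p = q"
      using ab param_coord[OF is_chart[OF c(1)]] by (simp add: B_def dom_def coord_def) metis
    then show "a = b"
      using ab tangent_space_eqI[OF _ _ c(1)] by (auto simp: B_def dom_def coord_def)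
  qed
  have dom: "(x, v + s *\<^sub>R w) \<in> dom B" for s
    using c tangent_space_add_scaleR[OF v w] by (simp add: B_def dom_def)
  have coord: "coord B (x, v + s *\<^sub>R w) = (coord c x, v c) + s *\<^sub>R (0, w c)" for s
    by (simp add: B_def coord_def scaleR_fun_def)
  have param: "param B ((coord c x, v c) + s *\<^sub>R (0, w c)) = (x, v + s *\<^sub>R w)" for s
    unfolding coord[symmetric] param_def using inj dom by simp
  let ?T = "I \<inter> (\<lambda>s. R x (v + s *\<^sub>R w)) -` dom c'"
  have "(coord c x, v c) + s *\<^sub>R (0, w c) \<in> ?W \<longleftrightarrow> R x (v + s *\<^sub>R w) \<in> dom c'" for s
    unfolding coord[symmetric] using inj dom by (auto dest: inj_onD)
  then have T: "?T = (\<lambda>s. (coord c x, v c) + s *\<^sub>R (0, w c)) -` ?W \<inter> I"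
    by blast
  have "continuous_on I (\<lambda>s. (coord c x, v c) + s *\<^sub>R (0, w c))"
    by (intro continuous_intros)
  then show op: "open ?T"
    unfolding T using I W(1) by (simp add: continuous_on_open_vimage)
  have "smooth_on ?T (\<lambda>s. (coord c' \<circ> ?h \<circ> param B) ((coord c x, v c) + s *\<^sub>R (0, w c)))"
    by (rule smooth_on_compose_line[OF op _ W(2)]) (use T in blast)
  then show "smooth_on ?T (coord c' \<circ> (\<lambda>s. R x (v + s *\<^sub>R w)))"
    unfolding o_apply param by (simp add: o_def)
qed

end

section \<open>The Riemannian metric in coordinates\<close>

locale riemannian_manifold = smooth_manifold A
  for A :: "('m::topological_space, 'e::euclidean_space) chart set" +
  fixes g :: "'m \<Rightarrow> ('m, 'e) tvec \<Rightarrow> ('m, 'e) tvec \<Rightarrow> real"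
  assumes riemannian_metric: "riemannian_metric A g"
begin

lemma metric_sym_linear:
  assumes "u \<in> tangent_space A p" "v \<in> tangent_space A p" "w \<in> tangent_space A p"
  shows "g p u v = g p v u" "g p (a *\<^sub>R u + b *\<^sub>R v) w = a * g p u w + b * g p v w"
proof -
  have "\<forall>p. \<forall>u\<in>tangent_space A p. \<forall>v\<in>tangent_space A p. \<forall>w\<in>tangent_space A p. \<forall>a b.
      g p u v = g p v u \<and> g p (a *\<^sub>R u + b *\<^sub>R v) w = a * g p u w + b * g p v w"
    using riemannian_metric unfolding riemannian_metric_def by (rule conjunct1)
  then show "g p u v = g p v u" "g p (a *\<^sub>R u + b *\<^sub>R v) w = a * g p u w + b * g p v w"
    using assms by metis+
qed

lemma metric_nonneg:
  assumes "v \<in> tangent_space A p"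
  shows "g p v v \<ge> 0"
proof (cases "v = 0")
  case True
  \<comment> \<open>Positivity is postulated for nonzero vectors; at zero the value comes from
    linearity with zero coefficients.\<close>
  have "g p 0 0 = 0"
    using metric_sym_linear(2)[OF zero_in_tangent_space zero_in_tangent_space zero_in_tangent_space,
        where a = 0 and b = 0] by simp
  with True show ?thesis
    by simp
next
  case False
  have "\<forall>p. \<forall>v\<in>tangent_space A p. v \<noteq> 0 \<longrightarrow> g p v v > 0"
    using riemannian_metric unfolding riemannian_metric_def by (elim conjE)
  with False assms show ?thesis
    by (meson less_imp_le)
qed

lemma tnorm_nonneg: "v \<in> tangent_space A p \<Longrightarrow> tnorm g p v \<ge> 0"
  by (simp add: tnorm_def metric_nonneg)

text \<open>\<open>riemannian_metric\<close> asks only for smoothness of \<open>G\<close> and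
  agreement with \<open>g\<close>. Bilinearity is inherited from \<open>g\<close>, because every
  coordinate vector lifts to a tangent vector.\<close>

lemma metric_coefficients:
  assumes c: "c \<in> A"
  obtains G where "\<And>a b. continuous_on (coord c ` dom c) (\<lambda>u. G u a b)"
    and "\<And>u. u \<in> coord c ` dom c \<Longrightarrow> bilinear (G u)"
    and "\<And>p v w. \<lbrakk>p \<in> dom c; v \<in> tangent_space A p; w \<in> tangent_space A p\<rbrakk> \<Longrightarrow>
      g p v w = G (coord c p) (v c) (w c)"
proof -
  obtain G where smooth: "\<And>a b. smooth_on (coord c ` dom c) (\<lambda>u. G u a b)"
    and G: "\<And>p v w. \<lbrakk>p \<in> dom c; v \<in> tangent_space A p; w \<in> tangent_space A p\<rbrakk> \<Longrightarrow>
      g p v w = G (coord c p) (v c) (w c)"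
    using riemannian_metric[unfolded riemannian_metric_def, THEN conjunct2, THEN conjunct2,
        THEN bspec, OF c] by metis
  have bil: "bilinear (G (coord c p))" if p: "p \<in> dom c" for p
  proof -
    have comb: "G (coord c p) (a *\<^sub>R u + b *\<^sub>R v) w = a * G (coord c p) u w + b * G (coord c p) v w"
      and sym: "G (coord c p) u v = G (coord c p) v u" for a b u v w
    proof -
      obtain U V W where UVW: "U \<in> tangent_space A p" "U c = u" "V \<in> tangent_space A p" "V c = v"
          "W \<in> tangent_space A p" "W c = w"
        using tangent_space_lift[OF c p] by metis
      have g: "g p U V = g p V U" "g p (a *\<^sub>R U + b *\<^sub>R V) W = a * g p U W + b * g p V W"
        using metric_sym_linear[OF UVW(1,3,5)] by auto
      have mem: "a *\<^sub>R U + b *\<^sub>R V \<in> tangent_space A p"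
        using tangent_space_add_scaleR[OF tangent_space_add_scaleR[OF zero_in_tangent_space UVW(1)] UVW(3)]
        by simp
      have "(a *\<^sub>R U + b *\<^sub>R V) c = a *\<^sub>R u + b *\<^sub>R v"
        using UVW by (simp add: scaleR_fun_def)
      then show "G (coord c p) (a *\<^sub>R u + b *\<^sub>R v) w = a * G (coord c p) u w + b * G (coord c p) v w"
        using g(2) G[OF p mem UVW(5)] G[OF p UVW(1,5)] G[OF p UVW(3,5)] UVW by simp
      show "G (coord c p) u v = G (coord c p) v u"
        using g(1) G[OF p UVW(1,3)] G[OF p UVW(3,1)] UVW by simp
    qed
    \<comment> \<open>Coefficients 1 and 1 give additivity, a second coefficient 0 gives
      homogeneity.\<close>
    have "linear (\<lambda>u. G (coord c p) u w)" for w
      using comb[of 1 _ 1] comb[of _ _ 0] by (intro linearI) auto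
    then show ?thesis
      using sym by (simp add: bilinear_def)
  qed
  show thesis
    using that[of G] smooth_on_continuous_on[OF smooth] bil G by blast
qed

text \<open>Near \<open>p\<close> the finitely many metric coefficients stay bounded by continuity,
  and expanding a vector in the basis turns this into a bound on the quadratic form.\<close>

lemma tnorm_locally_le_norm_coord:
  assumes c: "c \<in> A" and p: "p \<in> dom c"
  obtains C r where "C \<ge> 0" "r > 0" "ball (coord c p) r \<subseteq> coord c ` dom c"
    and "\<And>q v. \<lbrakk>q \<in> dom c; coord c q \<in> ball (coord c p) r; v \<in> tangent_space A q\<rbrakk> \<Longrightarrow>
      tnorm g q v \<le> C * norm (v c)"
proof -
  obtain G where cont: "\<And>a b. continuous_on (coord c ` dom c) (\<lambda>u. G u a b)"
    and bil: "\<And>u. u \<in> coord c ` dom c \<Longrightarrow> bilinear (G u)"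
    and G: "\<And>p v w. \<lbrakk>p \<in> dom c; v \<in> tangent_space A p; w \<in> tangent_space A p\<rbrakk> \<Longrightarrow>
      g p v w = G (coord c p) (v c) (w c)"
    using metric_coefficients[OF c] by blast
  let ?u = "coord c p"
  let ?B = "(Basis :: 'e set) \<times> (Basis :: 'e set)"
  \<comment> \<open>The added 1 leaves room for each coefficient to vary near
    \<open>p\<close>.\<close>
  define M where "M = (\<Sum>(i, j)\<in>?B. \<bar>G ?u i j\<bar> + 1)"
  have "\<forall>\<^sub>F z in nhds ?u. \<bar>G z i j\<bar> < \<bar>G ?u i j\<bar> + 1" for i j
  proof -
    have "isCont (\<lambda>u. G u i j) ?u"
      using cont p open_coord_dom[OF c] by (simp add: continuous_on_eq_continuous_at)
    then have "((\<lambda>u. \<bar>G u i j\<bar>) \<longlongrightarrow> \<bar>G ?u i j\<bar>) (nhds ?u)"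
      by (intro tendsto_rabs) (simp add: isCont_def tendsto_nhds_iff)
    then show ?thesis
      by (rule order_tendstoD) simp
  qed
  \<comment> \<open>The basis is finite, so one neighbourhood serves all coefficients at
    once.\<close>
  then have "\<forall>\<^sub>F z in nhds ?u. \<forall>ij\<in>?B. \<bar>G z (fst ij) (snd ij)\<bar> < \<bar>G ?u (fst ij) (snd ij)\<bar> + 1"
    by (intro eventually_ball_finite) auto
  moreover have "\<forall>\<^sub>F z in nhds ?u. z \<in> coord c ` dom c"
    using open_coord_dom[OF c] p by (auto intro: eventually_nhds_in_open)
  ultimately have "\<forall>\<^sub>F z in nhds ?u. z \<in> coord c ` dom c \<and>
      (\<forall>ij\<in>?B. \<bar>G z (fst ij) (snd ij)\<bar> < \<bar>G ?u (fst ij) (snd ij)\<bar> + 1)"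
    by (rule eventually_conj[rotated])
  then obtain r where r: "r > 0" "\<forall>z. dist z ?u < r \<longrightarrow> z \<in> coord c ` dom c \<and>
      (\<forall>ij\<in>?B. \<bar>G z (fst ij) (snd ij)\<bar> < \<bar>G ?u (fst ij) (snd ij)\<bar> + 1)"
    unfolding eventually_nhds_metric by (elim exE conjE) (rule that)
  have dom: "z \<in> coord c ` dom c" if "dist z ?u < r" for z
    using r(2) that by simp
  have coeff: "\<bar>G z i j\<bar> \<le> \<bar>G ?u i j\<bar> + 1" if "dist z ?u < r" "i \<in> Basis" "j \<in> Basis" for z i j
    using r(2)[rule_format, OF that(1)] that(2,3) by force
  have bound: "G z w w \<le> M * (norm w)\<^sup>2" if z: "dist z ?u < r" for z w
  proof -
    have "G z w w = G z (\<Sum>i\<in>Basis. (w \<bullet> i) *\<^sub>R i) (\<Sum>i\<in>Basis. (w \<bullet> i) *\<^sub>R i)"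
      by (simp add: euclidean_representation)
    also have "\<dots> = (\<Sum>(i, j)\<in>?B. G z ((w \<bullet> i) *\<^sub>R i) ((w \<bullet> j) *\<^sub>R j))"
      by (rule bilinear_sum[OF bil[OF dom[OF z]]])
    also have "\<dots> = (\<Sum>(i, j)\<in>?B. (w \<bullet> i) * (w \<bullet> j) * G z i j)"
      using bil[OF dom[OF z]] by (simp add: bilinear_lmul bilinear_rmul mult.assoc)
    also have "\<dots> \<le> (\<Sum>(i, j)\<in>?B. (norm w)\<^sup>2 * (\<bar>G ?u i j\<bar> + 1))"
    proof (rule sum_mono)
      fix ij assume ij: "ij \<in> ?B"
      obtain i j where [simp]: "ij = (i, j)"
        by fastforce
      have "\<bar>w \<bullet> i\<bar> * \<bar>w \<bullet> j\<bar> * \<bar>G z i j\<bar> \<le> norm w * norm w * (\<bar>G ?u i j\<bar> + 1)"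
        using ij coeff[OF z] by (intro mult_mono) (auto simp: Basis_le_norm)
      then show "(case ij of (i, j) \<Rightarrow> (w \<bullet> i) * (w \<bullet> j) * G z i j) \<le>
          (case ij of (i, j) \<Rightarrow> (norm w)\<^sup>2 * (\<bar>G ?u i j\<bar> + 1))"
        using abs_ge_self[of "(w \<bullet> i) * (w \<bullet> j) * G z i j"] by (simp add: abs_mult power2_eq_square)
    qed
    finally show ?thesis
      by (simp add: M_def sum_distrib_left mult.commute case_prod_unfold)
  qed
  have M: "M \<ge> 0"
    by (auto simp: M_def intro!: sum_nonneg)
  show thesis
  proof
    show "sqrt M \<ge> 0" "r > 0"
      using M r by auto
    show "ball ?u r \<subseteq> coord c ` dom c"
      using dom by (auto simp: dist_commute)
    show "tnorm g q v \<le> sqrt M * norm (v c)"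
      if "q \<in> dom c" "coord c q \<in> ball ?u r" "v \<in> tangent_space A q" for q v
    proof -
      have "tnorm g q v \<le> sqrt (M * (norm (v c))\<^sup>2)"
        using bound[of "coord c q" "v c"] G[of q v v] that
        by (simp add: tnorm_def dist_commute)
      then show ?thesis
        by (simp add: real_sqrt_mult)
    qed
  qed
qed

section \<open>Curve lengths and the Riemannian distance in a chart\<close>

lemma curve_length_nonneg:
  assumes "\<epsilon> > 0" "smooth_curve A {-\<epsilon><..<1+\<epsilon>} \<gamma>"
  shows "curve_length A g \<gamma> \<ge> 0"
proof -
  have "tnorm g (\<gamma> s) (velocity A \<gamma> s) \<ge> 0" if "s \<in> {0..1}" for s
    using velocity_in_tangent_space[OF assms(2)] assms(1) that by (auto intro: tnorm_nonneg)
  \<comment> \<open>Integrability of the speed need not be shown: without it \<open>integral\<close>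
    has the default value 0.\<close>
  then show ?thesis
    unfolding curve_length_def
    by (cases "(\<lambda>s. tnorm g (\<gamma> s) (velocity A \<gamma> s)) integrable_on {0..1}")
      (auto simp: not_integrable_integral intro: integral_nonneg)
qed

lemma pw_smooth_path_nonneg: "pw_smooth_path A g p q l \<Longrightarrow> l \<ge> 0"
  by (induction rule: pw_smooth_path.induct) (auto dest: curve_length_nonneg)

text \<open>Lengths are nonnegative, so the infimum is over a set bounded below, and the given path
  makes that set nonempty. Without a path, \<open>Inf\<close> of the empty set would carry no
  information.\<close>

lemma abs_rdist_le:
  assumes "pw_smooth_path A g p q l"
  shows "\<bar>rdist A g p q\<bar> \<le> l"
proof -
  have "rdist A g p q \<le> l"
    unfolding rdist_def using assms
    by (intro cInf_lower) (auto intro!: bdd_belowI[where m = 0] dest: pw_smooth_path_nonneg)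
  moreover have "0 \<le> rdist A g p q"
    unfolding rdist_def using assms by (intro cInf_greatest) (auto dest: pw_smooth_path_nonneg)
  ultimately show ?thesis
    by simp
qed

text \<open>The straight coordinate segment from \<open>u\<close> to \<open>v\<close> is a
  competitor in the infimum, and its speed is controlled by the local comparison of norms.\<close>

lemma rdist_locally_le_coord_dist:
  assumes c: "c \<in> A" and p: "p \<in> dom c"
  obtains C r where "r > 0" "\<And>u v. \<lbrakk>u \<in> ball (coord c p) r; v \<in> ball (coord c p) r\<rbrakk> \<Longrightarrow>
      \<bar>rdist A g (param c u) (param c v)\<bar> \<le> C * norm (u - v)"
proof -
  obtain C r where C: "C \<ge> 0" and r: "r > 0" "ball (coord c p) r \<subseteq> coord c ` dom c"
    and le: "\<And>q v. \<lbrakk>q \<in> dom c; coord c q \<in> ball (coord c p) r; v \<in> tangent_space A q\<rbrakk> \<Longrightarrow>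
      tnorm g q v \<le> C * norm (v c)"
    using tnorm_locally_le_norm_coord[OF c p] by blast
  \<comment> \<open>A segment must be smooth on an open interval around [0,1], here from -1 to 2.
    There \<bar>1 - s\<bar> + \<bar>s\<bar> is at most 3, so end points within \<open>r/3\<close>
    keep the extended line within \<open>r\<close>.\<close>
  have "\<bar>rdist A g (param c u) (param c v)\<bar> \<le> C * norm (u - v)"
    if uv: "u \<in> ball (coord c p) (r/3)" "v \<in> ball (coord c p) (r/3)" for u v
  proof -
    define \<gamma> where "\<gamma> = (\<lambda>s. param c (u + s *\<^sub>R (v - u)))"
    let ?I = "{-1<..<1+1::real}"
    have ball: "u + s *\<^sub>R (v - u) \<in> ball (coord c p) r" if "s \<in> ?I" for s
    proof -
      have "coord c p - (u + s *\<^sub>R (v - u)) = (1 - s) *\<^sub>R (coord c p - u) + s *\<^sub>R (coord c p - v)"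
        by (simp add: algebra_simps)
      then have "norm (coord c p - (u + s *\<^sub>R (v - u))) \<le>
          \<bar>1 - s\<bar> * norm (coord c p - u) + \<bar>s\<bar> * norm (coord c p - v)"
        by (metis norm_scaleR norm_triangle_ineq)
      also have "\<dots> \<le> \<bar>1 - s\<bar> * max (norm (coord c p - u)) (norm (coord c p - v))
          + \<bar>s\<bar> * max (norm (coord c p - u)) (norm (coord c p - v))"
        by (intro add_mono mult_left_mono) auto
      also have "\<dots> = (\<bar>1 - s\<bar> + \<bar>s\<bar>) * max (norm (coord c p - u)) (norm (coord c p - v))"
        by (simp add: algebra_simps)
      also have "\<dots> \<le> 3 * max (norm (coord c p - u)) (norm (coord c p - v))"
        using that by (intro mult_right_mono) (auto simp: le_max_iff_disj)
      also have "\<dots> < r"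
        using uv by (simp add: dist_norm)
      finally show ?thesis
        by (simp add: dist_norm)
    qed
    then have sub: "u + s *\<^sub>R (v - u) \<in> coord c ` dom c" if "s \<in> ?I" for s
      using r(2) that by blast
    have I: "open ?I"
      by simp
    have smooth: "smooth_curve A ?I \<gamma>"
      unfolding \<gamma>_def by (rule smooth_curve_coordinate_line[OF c I sub])
    have speed: "tnorm g (\<gamma> s) (velocity A \<gamma> s) \<le> C * norm (u - v)" if s: "s \<in> {0..1}" for s
    proof -
      have s': "s \<in> ?I"
        using s by auto
      have "\<gamma> s \<in> dom c" "coord c (\<gamma> s) \<in> ball (coord c p) r"
        using coord_param[OF is_chart[OF c] sub[OF s']] ball[OF s'] by (auto simp: \<gamma>_def)
      moreover have "velocity A \<gamma> s c = v - u"
        unfolding \<gamma>_def by (rule velocity_coordinate_line[OF c I sub s'])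
      ultimately show ?thesis
        using le[OF _ _ velocity_in_tangent_space[OF smooth s']] by (simp add: norm_minus_commute)
    qed
    have "curve_length A g \<gamma> \<le> C * norm (u - v)"
    proof (cases "(\<lambda>s. tnorm g (\<gamma> s) (velocity A \<gamma> s)) integrable_on {0..1}")
      case True
      then have "curve_length A g \<gamma> \<le> integral {0..1::real} (\<lambda>s. C * norm (u - v))"
        unfolding curve_length_def by (rule integral_le) (use speed in auto)
      then show ?thesis
        by simp
    next
      \<comment> \<open>The length is then the default value 0, and \<open>C\<close> is
        nonnegative.\<close>
      case False
      then show ?thesis
        using C by (simp add: curve_length_def not_integrable_integral)
    qed
    \<comment> \<open>The single segment is followed by the constant path of length 0.\<close>
    moreover have "pw_smooth_path A g (\<gamma> 0) (\<gamma> 1) (curve_length A g \<gamma> + 0)"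
      by (rule pw_smooth_path.segment[OF _ smooth pw_smooth_path.const]) simp
    ultimately show ?thesis
      using abs_rdist_le by (fastforce simp: \<gamma>_def)
  qed
  then show thesis
    using that[of "r/3" C] r by auto
qed

section \<open>Locally Lipschitz and semismooth functions in charts and along curves\<close>

lemma locally_lipschitz_in_chart:
  assumes f: "locally_lipschitz A g f" and c: "c \<in> A" and p: "p \<in> dom c"
  obtains K r where "r > 0" "\<And>u v. \<lbrakk>u \<in> ball (coord c p) r; v \<in> ball (coord c p) r\<rbrakk> \<Longrightarrow>
      \<bar>f (param c u) - f (param c v)\<bar> \<le> K * norm (u - v)"
proof -
  obtain U L where U: "open U" "p \<in> U" and L: "\<forall>y\<in>U. \<forall>z\<in>U. \<bar>f y - f z\<bar> \<le> L * rdist A g y z"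
    using f[unfolded locally_lipschitz_def, THEN spec, of p] by (elim exE conjE) (rule that)
  obtain C r where r: "r > 0" and le: "\<And>u v. \<lbrakk>u \<in> ball (coord c p) r; v \<in> ball (coord c p) r\<rbrakk> \<Longrightarrow>
      \<bar>rdist A g (param c u) (param c v)\<bar> \<le> C * norm (u - v)"
    by (rule rdist_locally_le_coord_dist[OF c p]) (rule that)
  \<comment> \<open>A smaller ball keeps the parametrized points in \<open>U\<close>, where the
    Lipschitz estimate holds.\<close>
  have "open (coord c ` (dom c \<inter> U))" "coord c p \<in> coord c ` (dom c \<inter> U)"
    using open_coord_image[OF is_chart[OF c] U(1)] p U by auto
  then obtain r' where r': "r' > 0" "ball (coord c p) r' \<subseteq> coord c ` (dom c \<inter> U)"
    by (rule openE)
  have "\<bar>f (param c u) - f (param c v)\<bar> \<le> (\<bar>L\<bar> * C) * norm (u - v)"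
    if "u \<in> ball (coord c p) (min r r')" "v \<in> ball (coord c p) (min r r')" for u v
  proof -
    have "u \<in> coord c ` (dom c \<inter> U)" "v \<in> coord c ` (dom c \<inter> U)"
      using r'(2) that by auto
    then have "param c u \<in> U" "param c v \<in> U"
      by (simp_all add: coord_image_Int[OF is_chart[OF c]])
    then have "\<bar>f (param c u) - f (param c v)\<bar> \<le> L * rdist A g (param c u) (param c v)"
      using L by simp
    \<comment> \<open>The sign of \<open>L\<close> is not prescribed, hence the absolute
      values.\<close>
    also have "\<dots> \<le> \<bar>L\<bar> * \<bar>rdist A g (param c u) (param c v)\<bar>"
      by (metis abs_ge_self abs_mult)
    also have "\<dots> \<le> \<bar>L\<bar> * (C * norm (u - v))"
      using that by (intro mult_left_mono le) auto
    finally show ?thesis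
      by (simp add: mult.assoc)
  qed
  then show thesis
    using that[of "min r r'"] r r' by auto
qed

text \<open>The limit \<open>L\<close> is the directional derivative in the chart provided by
  semismoothness, in direction \<open>\<xi> c\<close>. It depends on a curve only through its
  velocity, so it serves all curves; the given one supplies the existence clause.\<close>

lemma semismooth_has_mdir_deriv:
  assumes f: "semismooth_at A g f y" and \<gamma>: "curve_through A y \<xi> \<gamma>"
  obtains L where "has_mdir_deriv A f y \<xi> L"
proof -
  have lip: "locally_lipschitz A g f"
    using f unfolding semismooth_at_def by (rule conjunct1)
  obtain c where c: "c \<in> A" "y \<in> dom c"
    and dd: "\<forall>\<nu>. dir_differentiable (f \<circ> param c) (coord c y) \<nu>"
    using f unfolding semismooth_at_def all_conj_distrib by (elim conjE bexE) (rule that)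
  obtain L where L: "has_dir_deriv (f \<circ> param c) (coord c y) (\<xi> c) L"
    using dd unfolding dir_differentiable_def by blast
  obtain K r where K: "r > 0" "\<And>u v. \<lbrakk>u \<in> ball (coord c y) r; v \<in> ball (coord c y) r\<rbrakk> \<Longrightarrow>
      \<bar>f (param c u) - f (param c v)\<bar> \<le> K * norm (u - v)"
    by (rule locally_lipschitz_in_chart[OF lip c]) (rule that)
  have "((\<lambda>s. (f (\<gamma> s) - f y) / s) \<longlongrightarrow> L) (at_right 0)" if \<gamma>: "curve_through A y \<xi> \<gamma>" for \<gamma>
  proof -
    obtain \<epsilon> where \<epsilon>: "\<epsilon> > 0" "smooth_curve A {-\<epsilon><..<\<epsilon>} \<gamma>" and y: "\<gamma> 0 = y" and \<xi>: "velocity A \<gamma> 0 = \<xi>"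
      using \<gamma> unfolding curve_through_def by blast
    define \<beta> where "\<beta> = coord c \<circ> \<gamma>"
    have \<beta>0: "\<beta> 0 = coord c y"
      by (simp add: \<beta>_def y)
    have "(\<beta> has_vector_derivative \<xi> c) (at 0)"
      using smooth_curve_has_velocity[OF \<epsilon>(2) _ c(1), of 0] \<epsilon> c y \<xi> by (simp add: \<beta>_def)
    then have "((\<lambda>s. ((f \<circ> param c) (\<beta> s) - (f \<circ> param c) (\<beta> 0)) / s) \<longlongrightarrow> L) (at_right 0)"
      using K L by (intro lipschitz_dir_deriv_along_curve[where r = r and K = K and \<beta> = \<beta>
            and \<nu> = "\<xi> c" and F = "f \<circ> param c"]) (simp_all add: \<beta>0)
    \<comment> \<open>\<open>param c\<close> undoes \<open>coord c\<close> only on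
      \<open>dom c\<close>, which the curve does not leave for small \<open>s\<close>.\<close>
    moreover have "\<forall>\<^sub>F s in at_right 0. (f \<circ> param c) (\<beta> s) = f (\<gamma> s)"
    proof -
      have "open ({-\<epsilon><..<\<epsilon>} \<inter> \<gamma> -` dom c)" "0 \<in> {-\<epsilon><..<\<epsilon>} \<inter> \<gamma> -` dom c"
        using \<epsilon> c y by (auto simp: smooth_curve_iff)
      then have "\<forall>\<^sub>F s in nhds 0. s \<in> {-\<epsilon><..<\<epsilon>} \<inter> \<gamma> -` dom c"
        by (rule eventually_nhds_in_open)
      then have "\<forall>\<^sub>F s in at_right 0. s \<in> {-\<epsilon><..<\<epsilon>} \<inter> \<gamma> -` dom c"
        unfolding eventually_at_filter by (rule eventually_mono) simp
      then show ?thesis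
        by eventually_elim (use param_coord[OF is_chart[OF c(1)]] in \<open>simp add: \<beta>_def\<close>)
    qed
    then have "\<forall>\<^sub>F s in at_right 0. ((f \<circ> param c) (\<beta> s) - (f \<circ> param c) (\<beta> 0)) / s = (f (\<gamma> s) - f y) / s"
      by eventually_elim (simp add: \<beta>0 param_coord[OF is_chart[OF c(1)] c(2)])
    ultimately show ?thesis
      by (rule Lim_transform_eventually)
  qed
  then show thesis
    using that \<gamma> by (auto simp: has_mdir_deriv_def)
qed

end

section \<open>Directional derivatives of the pullback by the retraction\<close>

theorem lemma3p2:
  fixes A :: "('m::{t2_space, second_countable_topology}, real ^ 'd) chart set"
    and g :: "'m \<Rightarrow> ('m, real ^ 'd) tvec \<Rightarrow> ('m, real ^ 'd) tvec \<Rightarrow> real"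
    and R :: "'m \<Rightarrow> ('m, real ^ 'd) tvec \<Rightarrow> 'm"
    and f :: "'m \<Rightarrow> real"
    and x :: 'm
    and \<eta> :: "('m, real ^ 'd) tvec"
    and t :: real
  assumes "smooth_structure A"
    and "riemannian_metric A g"
    and "connected (UNIV :: 'm set)"
    and "complete_riemannian A g"
    and "mfd_retraction A R"
    and "inj_radius A g R > 0"
    and "f \<in> C1_sem A g"
    and "\<eta> \<in> tangent_space A x"
    and "ereal (tnorm g x (t *\<^sub>R \<eta>)) < inj_radius A g R"
  shows "dir_differentiable (f \<circ> R x) (t *\<^sub>R \<eta>) \<eta> \<and>
    mdir_differentiable A f (R x (t *\<^sub>R \<eta>)) (retr_diff A R x (t *\<^sub>R \<eta>) \<eta>) \<and>
    dir_deriv (f \<circ> R x) (t *\<^sub>R \<eta>) \<eta> =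
      mdir_deriv A f (R x (t *\<^sub>R \<eta>)) (retr_diff A R x (t *\<^sub>R \<eta>) \<eta>)"
proof -
  interpret riemannian_manifold A g
    by unfold_locales (fact assms)+
  let ?\<gamma> = "\<lambda>s. R x (t *\<^sub>R \<eta> + s *\<^sub>R \<eta>)"
  have "t *\<^sub>R \<eta> \<in> tangent_space A x"
    using tangent_space_add_scaleR[OF zero_in_tangent_space assms(8), of t] by simp
  then have "smooth_curve A {-1<..<1} ?\<gamma>"
    using assms(5,8) by (intro smooth_curve_retraction_line) auto
  \<comment> \<open>\<open>retr_diff\<close> is by definition the velocity of this curve at
    0.\<close>
  then have \<gamma>: "curve_through A (R x (t *\<^sub>R \<eta>)) (retr_diff A R x (t *\<^sub>R \<eta>) \<eta>) ?\<gamma>"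
    unfolding curve_through_def retr_diff_def by (auto intro!: exI[of _ 1])
  have "semismooth_at A g f (R x (t *\<^sub>R \<eta>))"
    using assms(7) by (simp add: C1_sem_def)
  then obtain L where L: "has_mdir_deriv A f (R x (t *\<^sub>R \<eta>)) (retr_diff A R x (t *\<^sub>R \<eta>) \<eta>) L"
    using semismooth_has_mdir_deriv \<gamma> by blast
  \<comment> \<open>The limit holds along every admissible curve; for this one the quotients are
    literally those of the pullback.\<close>
  then have "has_dir_deriv (f \<circ> R x) (t *\<^sub>R \<eta>) \<eta> L"
    using \<gamma> by (simp add: has_mdir_deriv_def has_dir_deriv_def)
  with L show ?thesis
    unfolding dir_differentiable_def mdir_differentiable_def
    by (auto simp: dir_deriv_eqI mdir_deriv_eqI)
qed

end
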